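(* Let $V$ be a finite set, let $P_1,\dots,P_K$ be a partition of $V$, and let $V=\mathrm{pos}\sqcup\mathrm{neg}$ be a partition of $V$ into two parts. Let $s_j>0$ for $j\in V$, let $w_i>0$ for $i=1,\dots,K$, and let $0<\lambda<1$. For $S\subseteq V$ define $$A_1(S)=\sum_{i=1}^K\sum_{j\in P_i\cap S}s_j\,w_i,$$ $$A_2(S)=\sum_{i=1}^K\min\Big(\sum_{j\in P_i\cap S}s_j,\ \lambda\Big)\,w_i,$$ $$A_3(S)=\sum_{i=1}^K\left[\min\Big(\sum_{j\in P_i\cap S\cap \mathrm{pos}}s_j,\ \lambda\Big)\,w_i+\min\Big(\sum_{j\in P_i\cap S\cap \mathrm{neg}}s_j,\ \lambda\Big)\,w_i\right],$$ $$A_4(S)=\sum_{i=1}^K\max_{j\in P_i\cap S}s_j,$$ $$A_5(S)=\sum_{i=1}^K\max_{j\in P_i\cap S\cap\mathrm{pos}}s_j+\sum_{i=1}^K\max_{j\in P_i\cap S\cap\mathrm{neg}}s_j,$$ where the maximum over an empty set is taken to be $0$. Then each of the functions $A_1,A_2,A_3,A_4,A_5:2^V\to\mathbb{R}$ is monotone and submodular. Moreover, $A_1$ is modular, i.e. both submodular and supermodular.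
   Context: A set function $f:2^V\to\mathbb{R}$ on a finite set $V$ is submodular if for all $A\subseteq B\subseteq V$ and all $x\in V\setminus B$ one has $f(A\cup\{x\})-f(A)\ge f(B\cup\{x\})-f(B)$. It is supermodular if $-f$ is submodular, and modular if it is both submodular and supermodular. It is monotone if $f(A)\le f(B)$ whenever $A\subseteq B\subseteq V$. Interpretation (not needed for the mathematics): $V$ is the set of sentences of a document, $P_i$ is the set of sentences about the $i$-th aspect, $w_i$ is the weight of that aspect, $s_j$ is the subjectivity score of sentence $j$, $\lambda$ is a budget threshold, and $\mathrm{pos}$, $\mathrm{neg}$ are the sentences of positive and of non-positive polarity score. *)

theory Defs
  imports Complex_Main "HOL-Library.Disjoint_Sets"
begin

definition submodular_on :: "'a set \<Rightarrow> ('a set \<Rightarrow> real) \<Rightarrow> bool" where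
  "submodular_on V f \<longleftrightarrow>
     (\<forall>A B x. A \<subseteq> B \<and> B \<subseteq> V \<and> x \<in> V - B \<longrightarrow>
        f (A \<union> {x}) - f A \<ge> f (B \<union> {x}) - f B)"

definition supermodular_on :: "'a set \<Rightarrow> ('a set \<Rightarrow> real) \<Rightarrow> bool" where
  "supermodular_on V f \<longleftrightarrow> submodular_on V (\<lambda>S. - f S)"

definition modular_on :: "'a set \<Rightarrow> ('a set \<Rightarrow> real) \<Rightarrow> bool" where
  "modular_on V f \<longleftrightarrow> submodular_on V f \<and> supermodular_on V f"

(* Blocks may be empty, unlike in partition_on; so this covers both readings of "partition". *)
definition indexed_partition :: "'a set \<Rightarrow> nat \<Rightarrow> (nat \<Rightarrow> 'a set) \<Rightarrow> bool" where
  "indexed_partition V K P \<longleftrightarrow> disjoint_family_on P {1..K} \<and> (\<Union>i\<in>{1..K}. P i) = V"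

(* Max {} is unspecified in the library; here the maximum over the empty set is 0. *)
definition max0 :: "('a \<Rightarrow> real) \<Rightarrow> 'a set \<Rightarrow> real" where
  "max0 s S = (if S = {} then 0 else Max (s ` S))"

definition A1 :: "nat \<Rightarrow> (nat \<Rightarrow> 'a set) \<Rightarrow> ('a \<Rightarrow> real) \<Rightarrow> (nat \<Rightarrow> real) \<Rightarrow> 'a set \<Rightarrow> real" where
  "A1 K P s w S = (\<Sum>i=1..K. \<Sum>j\<in>P i \<inter> S. s j * w i)"

definition A2 :: "nat \<Rightarrow> (nat \<Rightarrow> 'a set) \<Rightarrow> ('a \<Rightarrow> real) \<Rightarrow> (nat \<Rightarrow> real) \<Rightarrow> real \<Rightarrow> 'a set \<Rightarrow> real" where
  "A2 K P s w lam S = (\<Sum>i=1..K. min (\<Sum>j\<in>P i \<inter> S. s j) lam * w i)"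

definition A3 :: "nat \<Rightarrow> (nat \<Rightarrow> 'a set) \<Rightarrow> 'a set \<Rightarrow> 'a set \<Rightarrow> ('a \<Rightarrow> real) \<Rightarrow> (nat \<Rightarrow> real) \<Rightarrow> real \<Rightarrow> 'a set \<Rightarrow> real" where
  "A3 K P pos neg s w lam S =
     (\<Sum>i=1..K. min (\<Sum>j\<in>P i \<inter> S \<inter> pos. s j) lam * w i
              + min (\<Sum>j\<in>P i \<inter> S \<inter> neg. s j) lam * w i)"

definition A4 :: "nat \<Rightarrow> (nat \<Rightarrow> 'a set) \<Rightarrow> ('a \<Rightarrow> real) \<Rightarrow> 'a set \<Rightarrow> real" where
  "A4 K P s S = (\<Sum>i=1..K. max0 s (P i \<inter> S))"

definition A5 :: "nat \<Rightarrow> (nat \<Rightarrow> 'a set) \<Rightarrow> 'a set \<Rightarrow> 'a set \<Rightarrow> ('a \<Rightarrow> real) \<Rightarrow> 'a set \<Rightarrow> real" where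
  "A5 K P pos neg s S =
     (\<Sum>i=1..K. max0 s (P i \<inter> S \<inter> pos)) + (\<Sum>i=1..K. max0 s (P i \<inter> S \<inter> neg))"

end

theory Submission
  imports Defs
begin

text \<open>Monotone submodular functions are closed under sums, nonnegative scaling, truncation
  \<open>min f c\<close> and restriction \<open>S \<mapsto> f (C \<inter> S)\<close>.  Each of the five functions is built in this way from the
  additive function \<open>S \<mapsto> \<Sum>j\<in>S. s j\<close> or from \<open>max0 s\<close>, which satisfies
  \<open>max0 s (insert x S) = max (s x) (max0 s S)\<close>.\<close>

text \<open>Bundled because truncation does not preserve submodularity in general without
  monotonicity, so the closure rules carry both properties together.\<close>

definition monotone_submodular_on :: "'a set \<Rightarrow> ('a set \<Rightarrow> real) \<Rightarrow> bool" where
  "monotone_submodular_on V f \<longleftrightarrow> mono_on (Pow V) f \<and> submodular_on V f"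

lemma submodular_onI:
  assumes "\<And>A B x. A \<subseteq> B \<Longrightarrow> B \<subseteq> V \<Longrightarrow> x \<in> V \<Longrightarrow> x \<notin> B \<Longrightarrow>
    f (insert x B) - f B \<le> f (insert x A) - f A"
  shows "submodular_on V f"
  using assms by (simp add: submodular_on_def)

lemma submodular_onD:
  assumes "submodular_on V f" "A \<subseteq> B" "B \<subseteq> V" "x \<in> V" "x \<notin> B"
  shows "f (insert x B) - f B \<le> f (insert x A) - f A"
  using assms by (auto simp: submodular_on_def)

text \<open>Stated for submodularity alone, since it also has to apply to the negation of
  \<open>A1\<close>, which is antitone.\<close>

lemma submodular_on_sum:
  assumes "\<And>i. i \<in> I \<Longrightarrow> submodular_on V (f i)"
  shows "submodular_on V (\<lambda>S. \<Sum>i\<in>I. f i S)"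
proof (rule submodular_onI)
  fix A B x assume "A \<subseteq> B" "B \<subseteq> V" "x \<in> V" "x \<notin> B"
  then show "(\<Sum>i\<in>I. f i (insert x B)) - (\<Sum>i\<in>I. f i B)
      \<le> (\<Sum>i\<in>I. f i (insert x A)) - (\<Sum>i\<in>I. f i A)"
    unfolding sum_subtractf[symmetric]
    by (intro sum_mono submodular_onD[OF assms]) auto
qed

text \<open>An element outside \<open>C\<close> has zero gain on both sides; for one inside
  \<open>C\<close>, inserting commutes with intersecting.\<close>

lemma submodular_on_restrict:
  assumes "submodular_on V f"
  shows "submodular_on V (\<lambda>S. f (C \<inter> S))"
proof (rule submodular_onI)
  fix A B x assume *: "A \<subseteq> B" "B \<subseteq> V" "x \<in> V" "x \<notin> B"
  have "f (insert x (C \<inter> B)) - f (C \<inter> B) \<le> f (insert x (C \<inter> A)) - f (C \<inter> A)"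
    using * by (intro submodular_onD[OF assms]) auto
  then show "f (C \<inter> insert x B) - f (C \<inter> B) \<le> f (C \<inter> insert x A) - f (C \<inter> A)"
    by (cases "x \<in> C") auto
qed

text \<open>The gain of a new element \<open>x\<close> is \<open>s x\<close> for every set, so
  equality holds. The weights may have either sign: supermodularity of \<open>A1\<close> uses
  negated ones.\<close>

lemma submodular_on_additive:
  fixes s :: "'a \<Rightarrow> real"
  assumes "finite V"
  shows "submodular_on V (\<lambda>S. \<Sum>j\<in>S. s j)"
proof (rule submodular_onI)
  fix A B x assume *: "A \<subseteq> B" "B \<subseteq> V" "x \<in> V" "x \<notin> B"
  then have "finite A" "finite B" "x \<notin> A"
    using assms by (auto intro: finite_subset)
  with * show "sum s (insert x B) - sum s B \<le> sum s (insert x A) - sum s A"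
    by simp
qed

lemma monotone_submodular_on_sum:
  assumes "\<And>i. i \<in> I \<Longrightarrow> monotone_submodular_on V (f i)"
  shows "monotone_submodular_on V (\<lambda>S. \<Sum>i\<in>I. f i S)"
  unfolding monotone_submodular_on_def
proof
  show "mono_on (Pow V) (\<lambda>S. \<Sum>i\<in>I. f i S)"
    using assms unfolding monotone_submodular_on_def mono_on_def
    by (auto intro!: sum_mono)
qed (use assms in \<open>auto intro: submodular_on_sum simp: monotone_submodular_on_def\<close>)

lemma monotone_submodular_on_add:
  assumes "monotone_submodular_on V f" "monotone_submodular_on V g"
  shows "monotone_submodular_on V (\<lambda>S. f S + g S)"
  \<comment> \<open>The two summands are indexed by the type \<open>bool\<close>.\<close>
  using monotone_submodular_on_sum[of UNIV V "\<lambda>b. if b then f else g"] assms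
  by (simp add: UNIV_bool add.commute)

lemma monotone_submodular_on_scale:
  assumes "monotone_submodular_on V f" "0 \<le> c"
  shows "monotone_submodular_on V (\<lambda>S. f S * c)"
  using assms unfolding monotone_submodular_on_def mono_on_def submodular_on_def
  by (auto simp: mult_right_mono simp flip: left_diff_distrib)

lemma monotone_submodular_on_restrict:
  assumes "monotone_submodular_on V f"
  shows "monotone_submodular_on V (\<lambda>S. f (C \<inter> S))"
  unfolding monotone_submodular_on_def
proof
  show "mono_on (Pow V) (\<lambda>S. f (C \<inter> S))"
    using assms unfolding monotone_submodular_on_def mono_on_def
    by (metis Int_mono Pow_iff le_infI2 order_refl)
qed (use assms in \<open>auto intro: submodular_on_restrict simp: monotone_submodular_on_def\<close>)

text \<open>If \<open>f B\<close> has reached \<open>c\<close>, the gain at \<open>B\<close> is 0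
  and the gain at \<open>A\<close> is nonnegative by monotonicity. Otherwise \<open>f A\<close> is
  below \<open>c\<close> too. If \<open>f (insert x A)\<close> is at most \<open>c\<close>, the gain
  at \<open>A\<close> is not cut and that at \<open>B\<close> can only shrink; if it exceeds
  \<open>c\<close>, the gains are \<open>c - f B\<close> and \<open>c - f A\<close>.\<close>

lemma monotone_submodular_on_min:
  assumes "monotone_submodular_on V f"
  shows "monotone_submodular_on V (\<lambda>S. min (f S) c)"
proof -
  have mono: "f A \<le> f B" if "A \<subseteq> B" "B \<subseteq> V" for A B
    using assms that unfolding monotone_submodular_on_def mono_on_def by auto
  have "submodular_on V (\<lambda>S. min (f S) c)"
  proof (rule submodular_onI)
    fix A B x assume *: "A \<subseteq> B" "B \<subseteq> V" "x \<in> V" "x \<notin> B"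
    have "f (insert x B) - f B \<le> f (insert x A) - f A"
      using assms * by (intro submodular_onD) (auto simp: monotone_submodular_on_def)
    moreover have "f A \<le> f B" "f A \<le> f (insert x A)" "f B \<le> f (insert x B)"
        "f (insert x A) \<le> f (insert x B)"
      using * by (auto intro!: mono)
    ultimately show "min (f (insert x B)) c - min (f B) c
        \<le> min (f (insert x A)) c - min (f A) c"
      by (auto simp: min_def)
  qed
  moreover have "mono_on (Pow V) (\<lambda>S. min (f S) c)"
    using mono by (auto intro!: mono_onI min.mono)
  ultimately show ?thesis
    by (simp add: monotone_submodular_on_def)
qed

lemma monotone_submodular_on_additive:
  fixes s :: "'a \<Rightarrow> real"
  assumes "finite V" "\<And>j. j \<in> V \<Longrightarrow> 0 \<le> s j"
  shows "monotone_submodular_on V (\<lambda>S. \<Sum>j\<in>S. s j)"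
  unfolding monotone_submodular_on_def
proof
  show "mono_on (Pow V) (\<lambda>S. \<Sum>j\<in>S. s j)"
    using assms by (auto intro!: mono_onI sum_mono2 intro: finite_subset)
qed (use assms in \<open>simp add: submodular_on_additive\<close>)

text \<open>Nonnegativity of \<open>s x\<close> matters for empty \<open>S\<close>, where the
  default value 0 enters the maximum.\<close>

lemma max0_insert:
  assumes "finite S" "0 \<le> s x"
  shows "max0 s (insert x S) = max (s x) (max0 s S)"
  using assms by (simp add: max0_def)

lemma max0_mono:
  assumes "A \<subseteq> B" "finite B" "\<And>j. j \<in> B \<Longrightarrow> 0 \<le> s j"
  shows "max0 s A \<le> max0 s B"
proof (cases "A = {}")
  case True
  then show ?thesis
    \<comment> \<open>The default 0 of the empty set lies below any maximum of nonnegative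
      scores.\<close>
    using assms by (auto simp: max0_def Max_ge_iff)
next
  case False
  then show ?thesis
    using assms by (auto simp: max0_def intro!: Max_mono)
qed

lemma monotone_submodular_on_max0:
  assumes "finite V" "\<And>j. j \<in> V \<Longrightarrow> 0 \<le> s j"
  shows "monotone_submodular_on V (max0 s)"
proof -
  have mono: "max0 s A \<le> max0 s B" if "A \<subseteq> B" "B \<subseteq> V" for A B
    using that assms by (intro max0_mono) (auto intro: finite_subset)
  have "submodular_on V (max0 s)"
  proof (rule submodular_onI)
    fix A B x assume *: "A \<subseteq> B" "B \<subseteq> V" "x \<in> V" "x \<notin> B"
    then have "finite A" "finite B" "0 \<le> s x"
      using assms by (auto intro: finite_subset)
    \<comment> \<open>The gain of \<open>x\<close> at \<open>S\<close> is
      \<open>max (s x - max0 s S) 0\<close>, which decreases as \<open>max0 s S\<close>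
      grows.\<close>
    with mono[of A B] * show "max0 s (insert x B) - max0 s B \<le> max0 s (insert x A) - max0 s A"
      by (simp add: max0_insert)
  qed
  then show ?thesis
    using mono by (auto intro!: mono_onI simp: monotone_submodular_on_def)
qed

theorem mainTheorem1:
  fixes V pos neg :: "'a set" and K :: nat and P :: "nat \<Rightarrow> 'a set"
    and s :: "'a \<Rightarrow> real" and w :: "nat \<Rightarrow> real" and lam :: real
  assumes "finite V"
    and "indexed_partition V K P"
    and "pos \<union> neg = V" and "pos \<inter> neg = {}"
    and "\<And>j. j \<in> V \<Longrightarrow> s j > 0"
    and "\<And>i. i \<in> {1..K} \<Longrightarrow> w i > 0"
    and "0 < lam" and "lam < 1"
  shows "(mono_on (Pow V) (A1 K P s w) \<and> submodular_on V (A1 K P s w)) \<and>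
         (mono_on (Pow V) (A2 K P s w lam) \<and> submodular_on V (A2 K P s w lam)) \<and>
         (mono_on (Pow V) (A3 K P pos neg s w lam) \<and> submodular_on V (A3 K P pos neg s w lam)) \<and>
         (mono_on (Pow V) (A4 K P s) \<and> submodular_on V (A4 K P s)) \<and>
         (mono_on (Pow V) (A5 K P pos neg s) \<and> submodular_on V (A5 K P pos neg s)) \<and>
         modular_on V (A1 K P s w)"
proof -
  let ?ms = "monotone_submodular_on V"
  have s: "0 \<le> s j" if "j \<in> V" for j
    using assms(5)[OF that] by simp
  have w: "0 \<le> w i" if "i \<in> {1..K}" for i
    using assms(6)[OF that] by simp
  have additive: "?ms (\<lambda>S. \<Sum>j\<in>C \<inter> S. s j)" for C
    by (intro monotone_submodular_on_restrict monotone_submodular_on_additive assms(1) s)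
  have trunc: "?ms (\<lambda>S. min (\<Sum>j\<in>C \<inter> S. s j) lam * w i)" if "i \<in> {1..K}" for C i
    by (intro monotone_submodular_on_scale monotone_submodular_on_min additive w that)
  have max: "?ms (\<lambda>S. max0 s (C \<inter> S))" for C
    by (intro monotone_submodular_on_restrict monotone_submodular_on_max0 assms(1) s)
  \<comment> \<open>Collects everything independent of \<open>S\<close> into one set, so that the
    restriction form \<open>C \<inter> S\<close> applies.\<close>
  have Int_swap: "P i \<inter> S \<inter> pos = (P i \<inter> pos) \<inter> S" "P i \<inter> S \<inter> neg = (P i \<inter> neg) \<inter> S" for i S
    by auto

  have A1: "?ms (A1 K P s w)"
    \<comment> \<open>Pulling \<open>w i\<close> out of the inner sum exposes a scaled additive
      function.\<close>
    unfolding A1_def[abs_def] sum_distrib_right[symmetric]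
    by (intro monotone_submodular_on_sum monotone_submodular_on_scale additive w)
  have A2: "?ms (A2 K P s w lam)"
    unfolding A2_def[abs_def] by (intro monotone_submodular_on_sum trunc)
  have A3: "?ms (A3 K P pos neg s w lam)"
    unfolding A3_def[abs_def] Int_swap
    by (intro monotone_submodular_on_sum monotone_submodular_on_add trunc)
  have A4: "?ms (A4 K P s)"
    unfolding A4_def[abs_def] by (intro monotone_submodular_on_sum max)
  have A5: "?ms (A5 K P pos neg s)"
    unfolding A5_def[abs_def] Int_swap
    by (intro monotone_submodular_on_sum monotone_submodular_on_add max)
  have "supermodular_on V (A1 K P s w)"
    \<comment> \<open>The minus sign moves onto the individual terms, so the negation of
      \<open>A1\<close> is again a sum of restricted additive functions.\<close>
    unfolding supermodular_on_def A1_def sum_negf[symmetric]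
    by (intro submodular_on_sum submodular_on_restrict submodular_on_additive assms(1))
  with A1 A2 A3 A4 A5 show ?thesis
    by (simp add: monotone_submodular_on_def modular_on_def)
qed

end
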